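(* Let $G$ be a simplicial group. For every left $G$-space $X$ the morphism $$P_X\colon\mathbf h\mathbf tX\to X,\qquad(b,x,g)\mapsto g^{-1}x,$$ and for every space $p\colon Y\to BG$ over $BG$ the morphism $$I_Y\colon Y\to\mathbf t\mathbf hY,\qquad y\mapsto(p(y),y,1),$$ are homotopy equivalences of spaces (simplicial sets).
   Context: A space is a simplicial set; $\tilde\partial$ denotes the last face map ($\partial_n$ in degree $n$). $\Delta^{(1)}$ is the simplicial interval; a homotopy between maps $X\to X'$ is a map $X\times\Delta^{(1)}\to X'$. A homotopy equivalence of spaces is a map having an inverse up to such homotopies (no equivariance, or compatibility with maps to $BG$, is required of the inverse or the homotopies). $BG$ is the simplicial set with $BG_n=G_0\times\dots\times G_{n-1}$, elements $[g_0,\dots,g_{n-1}]$, with $\partial_i[g_0,\dots,g_{n-1}]=[g_0,\dots,g_{i-2},g_{i-1}\partial_ig_i,\partial_ig_{i+1},\dots,\partial_ig_{n-1}]$ (undefined components omitted) and $s_i[g_0,\dots,g_{n-1}]=[g_0,\dots,g_{i-1},1_i,s_ig_i,\dots,s_ig_{n-1}]$. Put $\tau_{BG}[g_0,\dots,g_{n-1}]=g_{n-1}\in G_{n-1}$. For a left $G$-space $X$, $\mathbf tX=EG\times_GX$ is the graded set $BG\times X$ with componentwise face and degeneracy maps, except that $\tilde\partial(b,x)=(\tilde\partial b,\tau_{BG}(b)\tilde\partial x)$; it is a space over $BG$ (a simplicial set with a map to $BG$) via the first projection. For a space $p\colon Y\to BG$ over $BG$, $\mathbf hY=Y\times^{BG}EG$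 is the graded set $Y\times G$ with componentwise structure maps except $\tilde\partial(y,g)=(\tilde\partial y,\tau_{BG}(p(y))\tilde\partial g)$, with left $G$-action $h\cdot(y,g)=(y,gh^{-1})$. As graded sets $\mathbf h\mathbf tX\cong BG\times X\times G$ (via $((b,x),g)\leftrightarrow(b,x,g)$) and $\mathbf t\mathbf hY\cong BG\times Y\times G$ (via $(b,(y,g))\leftrightarrow(b,y,g)$), and the formulas in the claim use these representations. *)

theory Defs
  imports "HOL-Algebra.Group"
begin

section \<open>Simplicial sets\<close>

text \<open>
  The sets of simplices of the various degrees live in one type and need not be disjoint, so
  every structure map carries the degree of its source: \<open>face X n i\<close> is the \<open>i\<close>-th face map
  out of degree \<open>n\<close> (of interest for \<open>n \<ge> 1\<close>, \<open>i \<le> n\<close>), \<open>degen X n i\<close> the \<open>i\<close>-th degeneracy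
  out of degree \<open>n\<close> (\<open>i \<le> n\<close>). Values outside the simplices are irrelevant throughout.
  Likewise, a map of graded sets is a function of type \<open>nat \<Rightarrow> 'a \<Rightarrow> 'b\<close>.
\<close>

record 'a sset =
  simplices :: "nat \<Rightarrow> 'a set"
  face :: "nat \<Rightarrow> nat \<Rightarrow> 'a \<Rightarrow> 'a"
  degen :: "nat \<Rightarrow> nat \<Rightarrow> 'a \<Rightarrow> 'a"

locale simplicial_set =
  fixes X :: "('a, 'z) sset_scheme"
  assumes face_closed:
      "\<lbrakk>x \<in> simplices X (Suc n); i \<le> Suc n\<rbrakk> \<Longrightarrow> face X (Suc n) i x \<in> simplices X n"
    and degen_closed:
      "\<lbrakk>x \<in> simplices X n; i \<le> n\<rbrakk> \<Longrightarrow> degen X n i x \<in> simplices X (Suc n)"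
    and face_face:
      "\<lbrakk>x \<in> simplices X (Suc (Suc n)); i < j; j \<le> Suc (Suc n)\<rbrakk> \<Longrightarrow>
        face X (Suc n) i (face X (Suc (Suc n)) j x) =
        face X (Suc n) (j - 1) (face X (Suc (Suc n)) i x)"
    and degen_degen:
      "\<lbrakk>x \<in> simplices X n; i \<le> j; j \<le> n\<rbrakk> \<Longrightarrow>
        degen X (Suc n) i (degen X n j x) = degen X (Suc n) (Suc j) (degen X n i x)"
    and face_degen_less:
      "\<lbrakk>x \<in> simplices X (Suc n); i < j; j \<le> Suc n\<rbrakk> \<Longrightarrow>
        face X (Suc (Suc n)) i (degen X (Suc n) j x) = degen X n (j - 1) (face X (Suc n) i x)"
    and face_degen_same:
      "\<lbrakk>x \<in> simplices X n; j \<le> n; i = j \<or> i = Suc j\<rbrakk> \<Longrightarrow>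
        face X (Suc n) i (degen X n j x) = x"
    and face_degen_greater:
      "\<lbrakk>x \<in> simplices X (Suc n); Suc j < i; i \<le> Suc (Suc n)\<rbrakk> \<Longrightarrow>
        face X (Suc (Suc n)) i (degen X (Suc n) j x) = degen X n j (face X (Suc n) (i - 1) x)"

locale simplicial_map = X: simplicial_set X + Y: simplicial_set Y
  for X :: "('a, 'z) sset_scheme" and Y :: "('b, 'w) sset_scheme" +
  fixes f :: "nat \<Rightarrow> 'a \<Rightarrow> 'b"
  assumes map_closed: "x \<in> simplices X n \<Longrightarrow> f n x \<in> simplices Y n"
    and map_face:
      "\<lbrakk>x \<in> simplices X (Suc n); i \<le> Suc n\<rbrakk> \<Longrightarrow>
        f n (face X (Suc n) i x) = face Y (Suc n) i (f (Suc n) x)"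
    and map_degen:
      "\<lbrakk>x \<in> simplices X n; i \<le> n\<rbrakk> \<Longrightarrow>
        f (Suc n) (degen X n i x) = degen Y n i (f n x)"

definition prod_sset :: "('a, 'z) sset_scheme \<Rightarrow> ('b, 'w) sset_scheme \<Rightarrow> ('a \<times> 'b) sset" where
  "prod_sset X Y =
    \<lparr>simplices = (\<lambda>n. simplices X n \<times> simplices Y n),
     face = (\<lambda>n i (x, y). (face X n i x, face Y n i y)),
     degen = (\<lambda>n i (x, y). (degen X n i x, degen Y n i y))\<rparr>"

text \<open>
  An \<open>n\<close>-simplex of the simplicial interval is a weakly increasing map from \<open>{0..n}\<close> to \<open>{0, 1}\<close>,
  given as the list of its \<open>n + 1\<close> values; faces omit and degeneracies repeat an entry.
\<close>

definition interval :: "nat list sset" where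
  "interval =
    \<lparr>simplices = (\<lambda>n. {v. length v = Suc n \<and> sorted v \<and> set v \<subseteq> {0, 1}}),
     face = (\<lambda>n i v. take i v @ drop (Suc i) v),
     degen = (\<lambda>n i v. take (Suc i) v @ drop i v)\<rparr>"

text \<open>
  Homotopies are single maps out of \<open>X \<times> interval\<close>, restricting to \<open>f\<close> over the vertex \<open>0\<close> and
  to \<open>g\<close> over the vertex \<open>1\<close>; for general \<open>X'\<close> this is not a symmetric relation.
\<close>

definition homotopic ::
  "('a, 'z) sset_scheme \<Rightarrow> ('b, 'w) sset_scheme \<Rightarrow> (nat \<Rightarrow> 'a \<Rightarrow> 'b) \<Rightarrow> (nat \<Rightarrow> 'a \<Rightarrow> 'b) \<Rightarrow> bool"
where
  "homotopic X X' f g \<longleftrightarrow>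
    (\<exists>H. simplicial_map (prod_sset X interval) X' H \<and>
      (\<forall>n. \<forall>x \<in> simplices X n.
        H n (x, replicate (Suc n) 0) = f n x \<and> H n (x, replicate (Suc n) 1) = g n x))"

definition homotopy_equivalence ::
  "('a, 'z) sset_scheme \<Rightarrow> ('b, 'w) sset_scheme \<Rightarrow> (nat \<Rightarrow> 'a \<Rightarrow> 'b) \<Rightarrow> bool"
where
  "homotopy_equivalence X Y f \<longleftrightarrow>
    simplicial_map X Y f \<and>
    (\<exists>q. simplicial_map Y X q \<and>
      homotopic X X (\<lambda>n. q n \<circ> f n) (\<lambda>n. id) \<and>
      homotopic Y Y (\<lambda>n. f n \<circ> q n) (\<lambda>n. id))"


section \<open>Simplicial groups, spaces with a group action, and spaces over a base\<close>

record 'g sgroup = "'g sset" +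
  gmult :: "nat \<Rightarrow> 'g \<Rightarrow> 'g \<Rightarrow> 'g"
  gone :: "nat \<Rightarrow> 'g"

definition grp :: "'g sgroup \<Rightarrow> nat \<Rightarrow> 'g monoid" where
  "grp G n = \<lparr>carrier = simplices G n, mult = gmult G n, one = gone G n\<rparr>"

locale simplicial_group = simplicial_set G for G :: "'g sgroup" +
  assumes group_grp: "group (grp G n)"
    and face_hom: "i \<le> Suc n \<Longrightarrow> face G (Suc n) i \<in> hom (grp G (Suc n)) (grp G n)"
    and degen_hom: "i \<le> n \<Longrightarrow> degen G n i \<in> hom (grp G n) (grp G (Suc n))"

record ('x, 'g) gspace = "'x sset" +
  act :: "nat \<Rightarrow> 'g \<Rightarrow> 'x \<Rightarrow> 'x"

locale left_gspace = G: simplicial_group G + X: simplicial_set X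
  for G :: "'g sgroup" and X :: "('x, 'g) gspace" +
  assumes act_closed:
      "\<lbrakk>g \<in> simplices G n; x \<in> simplices X n\<rbrakk> \<Longrightarrow> act X n g x \<in> simplices X n"
    and act_one: "x \<in> simplices X n \<Longrightarrow> act X n (gone G n) x = x"
    and act_mult:
      "\<lbrakk>g \<in> simplices G n; h \<in> simplices G n; x \<in> simplices X n\<rbrakk> \<Longrightarrow>
        act X n (gmult G n g h) x = act X n g (act X n h x)"
    and act_face:
      "\<lbrakk>g \<in> simplices G (Suc n); x \<in> simplices X (Suc n); i \<le> Suc n\<rbrakk> \<Longrightarrow>
        face X (Suc n) i (act X (Suc n) g x) =
        act X n (face G (Suc n) i g) (face X (Suc n) i x)"
    and act_degen:
      "\<lbrakk>g \<in> simplices G n; x \<in> simplices X n; i \<le> n\<rbrakk> \<Longrightarrow>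
        degen X n i (act X n g x) = act X (Suc n) (degen G n i g) (degen X n i x)"

locale gspace_map = X: left_gspace G X + X': left_gspace G X' + simplicial_map X X' f
  for G :: "'g sgroup" and X :: "('x, 'g) gspace" and X' :: "('x1, 'g) gspace" and f +
  assumes map_act:
      "\<lbrakk>g \<in> simplices G n; x \<in> simplices X n\<rbrakk> \<Longrightarrow> f n (act X n g x) = act X' n g (f n x)"

record ('y, 'b) over_space = "'y sset" +
  proj :: "nat \<Rightarrow> 'y \<Rightarrow> 'b"

locale space_over = simplicial_map Y B "proj Y"
  for B :: "('b, 'z) sset_scheme" and Y :: "('y, 'b) over_space"

locale space_over_map = Y: space_over B Y + Y': space_over B Y' + simplicial_map Y Y' f
  for B :: "('b, 'z) sset_scheme"
    and Y :: "('y, 'b) over_space" and Y' :: "('y1, 'b) over_space" and f +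
  assumes map_proj: "y \<in> simplices Y n \<Longrightarrow> proj Y' n (f n y) = proj Y n y"


section \<open>The classifying space and the functors t and h\<close>

text \<open>
  The element \<open>[g\<^sub>0, \<dots>, g\<^sub>n\<^sub>-\<^sub>1]\<close> of \<open>BG\<close> is a list, and \<open>k\<close> below is the position in the resulting
  list. In the faces, position \<open>i - 1\<close> holds the product of \<open>g\<^sub>i\<^sub>-\<^sub>1\<close> with the \<open>i\<close>-th face of \<open>g\<^sub>i\<close>;
  for \<open>i = 0\<close> and \<open>i = n\<close> this position does not occur.
\<close>

definition BG :: "'g sgroup \<Rightarrow> 'g list sset" where
  "BG G =
    \<lparr>simplices = (\<lambda>n. {gs. length gs = n \<and> (\<forall>k < n. gs ! k \<in> simplices G k)}),
     face = (\<lambda>n i gs.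
       map (\<lambda>k. if Suc k < i then gs ! k
                else if Suc k = i then gmult G k (gs ! k) (face G i i (gs ! i))
                else face G (Suc k) i (gs ! Suc k)) [0..<n - 1]),
     degen = (\<lambda>n i gs.
       map (\<lambda>k. if k < i then gs ! k
                else if k = i then gone G i
                else degen G (k - 1) i (gs ! (k - 1))) [0..<Suc n])\<rparr>"

text \<open>On the \<open>n\<close>-simplices of \<open>BG\<close>, \<open>n \<ge> 1\<close>, the function \<open>\<tau>\<close> takes values in degree \<open>n - 1\<close>.\<close>

definition tau_BG :: "'g list \<Rightarrow> 'g" where
  "tau_BG gs = last gs"

definition t_space :: "'g sgroup \<Rightarrow> ('x, 'g) gspace \<Rightarrow> ('g list \<times> 'x, 'g list) over_space" where
  "t_space G X =
    \<lparr>simplices = (\<lambda>n. simplices (BG G) n \<times> simplices X n),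
     face = (\<lambda>n i (b, x).
       (face (BG G) n i b,
        if i = n then act X (n - 1) (tau_BG b) (face X n i x) else face X n i x)),
     degen = (\<lambda>n i (b, x). (degen (BG G) n i b, degen X n i x)),
     proj = (\<lambda>n (b, x). b)\<rparr>"

definition h_space :: "'g sgroup \<Rightarrow> ('y, 'g list) over_space \<Rightarrow> ('y \<times> 'g, 'g) gspace" where
  "h_space G Y =
    \<lparr>simplices = (\<lambda>n. simplices Y n \<times> simplices G n),
     face = (\<lambda>n i (y, g).
       (face Y n i y,
        if i = n then gmult G (n - 1) (tau_BG (proj Y n y)) (face G n i g) else face G n i g)),
     degen = (\<lambda>n i (y, g). (degen Y n i y, degen G n i g)),
     act = (\<lambda>n h (y, g). (y, gmult G n g (inv\<^bsub>grp G n\<^esub> h)))\<rparr>"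

definition P_map ::
  "'g sgroup \<Rightarrow> ('x, 'g) gspace \<Rightarrow> nat \<Rightarrow> ('g list \<times> 'x) \<times> 'g \<Rightarrow> 'x"
where
  "P_map G X n = (\<lambda>((b, x), g). act X n (inv\<^bsub>grp G n\<^esub> g) x)"

definition I_map ::
  "'g sgroup \<Rightarrow> ('y, 'g list) over_space \<Rightarrow> nat \<Rightarrow> 'y \<Rightarrow> 'g list \<times> ('y \<times> 'g)"
where
  "I_map G Y n y = (proj Y n y, (y, gone G n))"

end

theory Submission
  imports Defs
begin

text \<open>
  The \<open>G\<close>-coordinates of the front faces of a simplex identify \<open>EG\<close>, and likewise the fibres of
  \<open>P\<close> and of the projection \<open>thY \<rightarrow> Y\<close>, with a simplicial set \<open>C\<close>, where \<open>C\<^sub>n = G\<^sub>0 \<times> \<dots> \<times> G\<^sub>n\<close>,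
  whose structure maps are homomorphisms in each coordinate and whose last face forgets the last
  coordinate. So \<open>htX\<close> is isomorphic to \<open>X \<times> C\<close> and \<open>thY\<close> to \<open>Y \<times> C\<close>, in such a way that \<open>P\<close>
  becomes a projection and \<open>I\<close> the inclusion at \<open>1 \<in> C\<close>. The map \<open>C \<times> interval \<rightarrow> C\<close> that keeps
  the \<open>j\<close>-th coordinate if \<open>v\<^sub>j = 1\<close> and replaces it by \<open>1\<close> if \<open>v\<^sub>j = 0\<close> contracts \<open>C\<close>.
\<close>

section \<open>Products and the interval\<close>

text \<open>The laws involve only these three fields, so they pass between records with different
  further fields; \<open>t_space\<close> and \<open>h_space\<close> inherit them from
  \<open>twisted\<close> in this way.\<close>

lemma simplicial_set_cong:
  assumes "simplicial_set X" "simplices Y = simplices X" "face Y = face X" "degen Y = degen X"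
  shows "simplicial_set Y"
  using assms unfolding simplicial_set_def by simp

lemma prod_sset_sel [simp]:
  "simplices (prod_sset X Y) n = simplices X n \<times> simplices Y n"
  "face (prod_sset X Y) n i (x, y) = (face X n i x, face Y n i y)"
  "degen (prod_sset X Y) n i (x, y) = (degen X n i x, degen Y n i y)"
  by (simp_all add: prod_sset_def)

lemma simplicial_set_prod:
  assumes "simplicial_set X" "simplicial_set Y"
  shows "simplicial_set (prod_sset X Y)"
proof -
  interpret X: simplicial_set X by fact
  interpret Y: simplicial_set Y by fact
  show ?thesis
    by unfold_locales
      (auto simp: X.face_closed Y.face_closed X.degen_closed Y.degen_closed
        X.face_face Y.face_face X.degen_degen Y.degen_degen
        X.face_degen_less Y.face_degen_less X.face_degen_same Y.face_degen_same
        X.face_degen_greater Y.face_degen_greater)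
qed

section \<open>The simplicial interval\<close>

lemma interval_simplices:
  "v \<in> simplices interval n \<longleftrightarrow> length v = Suc n \<and> sorted v \<and> set v \<subseteq> {0, 1}"
  by (simp add: interval_def)

lemma interval_face: "face interval n i v = take i v @ drop (Suc i) v"
  by (simp add: interval_def)

lemma interval_degen: "degen interval n i v = take (Suc i) v @ drop i v"
  by (simp add: interval_def)

lemma nth_interval_face:
  assumes "i < length v" "Suc k < length v"
  shows "face interval n i v ! k = (if k < i then v ! k else v ! Suc k)"
  using assms by (auto simp: interval_face nth_append min_def)

lemma nth_interval_degen:
  assumes "i < length v" "k \<le> length v"
  shows "degen interval n i v ! k = (if k \<le> i then v ! k else v ! (k - 1))"
  using assms by (auto simp: interval_degen nth_append min_def le_less_Suc_eq Suc_diff_Suc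
      simp flip: less_Suc_eq_le)

lemma length_interval_face: "i < length v \<Longrightarrow> length (face interval n i v) = length v - 1"
  by (simp add: interval_face)

lemma length_interval_degen: "i < length v \<Longrightarrow> length (degen interval n i v) = Suc (length v)"
  by (simp add: interval_degen)

lemma simplicial_set_interval: "simplicial_set interval"
proof
  fix v :: "nat list" and n i
  assume v: "v \<in> simplices interval (Suc n)" "i \<le> Suc n"
  then have "sorted (face interval (Suc n) i v)"
    by (auto simp: sorted_iff_nth_mono interval_simplices length_interval_face nth_interval_face)
  then show "face interval (Suc n) i v \<in> simplices interval n"
    using v set_take_subset[of i v] set_drop_subset[of "Suc i" v]
    by (auto simp: interval_simplices length_interval_face) (auto simp: interval_face)
next
  fix v :: "nat list" and n i
  assume v: "v \<in> simplices interval n" "i \<le> n"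
  then have "sorted (degen interval n i v)"
    by (auto simp: sorted_iff_nth_mono interval_simplices length_interval_degen nth_interval_degen)
  then show "degen interval n i v \<in> simplices interval (Suc n)"
    using v set_take_subset[of "Suc i" v] set_drop_subset[of i v]
    by (auto simp: interval_simplices length_interval_degen) (auto simp: interval_degen)
qed (rule nth_equalityI; force simp: interval_simplices length_interval_face length_interval_degen
    nth_interval_face nth_interval_degen)+

lemma interval_face_replicate:
  "i \<le> n \<Longrightarrow> face interval n i (replicate (Suc n) a) = replicate n a"
  by (simp add: interval_face min_def flip: replicate_Suc replicate_add)

text \<open>The value at the last vertex can change under the last face only, which makes it usable
  in the datum \<open>d\<close> of \<open>lift_exists\<close>.\<close>

lemma last_interval:
  assumes "v \<in> simplices interval n"
  shows "i < n \<Longrightarrow> last (face interval n i v) = last v"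
    and "i \<le> n \<Longrightarrow> last (degen interval n i v) = last v"
  using assms by (simp_all add: interval_simplices interval_face interval_degen)

section \<open>Cofree maps\<close>

text \<open>
  The last two conditions say that \<open>Z\<close> is the product of \<open>Y\<close> with the cofree simplicial set on \<open>K\<close>
  considered without its last face maps: a simplex of \<open>Z\<close> is determined by its image in \<open>Y\<close> and
  by the values of \<open>c\<close> on its front faces, and these can be prescribed arbitrarily.
\<close>

locale cofree_map = simplicial_map Z Y r + K: simplicial_set K
  for Z :: "('z, 'a) sset_scheme" and Y :: "('y, 'b) sset_scheme" and r
    and K :: "('k, 'c) sset_scheme" +
  fixes c :: "nat \<Rightarrow> 'z \<Rightarrow> 'k"
  assumes c_closed: "z \<in> simplices Z n \<Longrightarrow> c n z \<in> simplices K n"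
    and c_face:
      "\<lbrakk>z \<in> simplices Z (Suc n); i \<le> n\<rbrakk> \<Longrightarrow> c n (face Z (Suc n) i z) = face K (Suc n) i (c (Suc n) z)"
    and c_degen:
      "\<lbrakk>z \<in> simplices Z n; i \<le> n\<rbrakk> \<Longrightarrow> c (Suc n) (degen Z n i z) = degen K n i (c n z)"
    and ex1_0:
      "\<lbrakk>y \<in> simplices Y 0; k \<in> simplices K 0\<rbrakk> \<Longrightarrow> \<exists>!z. z \<in> simplices Z 0 \<and> r 0 z = y \<and> c 0 z = k"
    and ex1_Suc:
      "\<lbrakk>y \<in> simplices Y (Suc n); k \<in> simplices K (Suc n); z' \<in> simplices Z n;
        r n z' = face Y (Suc n) (Suc n) y\<rbrakk> \<Longrightarrow>
        \<exists>!z. z \<in> simplices Z (Suc n) \<and> r (Suc n) z = y \<and> c (Suc n) z = k \<and>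
          face Z (Suc n) (Suc n) z = z'"
begin

lemma eq_0I:
  assumes "z \<in> simplices Z 0" "z' \<in> simplices Z 0" "r 0 z = r 0 z'" "c 0 z = c 0 z'"
  shows "z = z'"
  using ex1_0[of "r 0 z'" "c 0 z'"] assms map_closed c_closed by blast

lemma eq_SucI:
  assumes "z \<in> simplices Z (Suc n)" "z' \<in> simplices Z (Suc n)"
    and "r (Suc n) z = r (Suc n) z'" "c (Suc n) z = c (Suc n) z'"
    and "face Z (Suc n) (Suc n) z = face Z (Suc n) (Suc n) z'"
  shows "z = z'"
proof -
  have "\<exists>!u. u \<in> simplices Z (Suc n) \<and> r (Suc n) u = r (Suc n) z' \<and> c (Suc n) u = c (Suc n) z' \<and>
      face Z (Suc n) (Suc n) u = face Z (Suc n) (Suc n) z'"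
    using assms(2) by (intro ex1_Suc) (auto simp: map_closed c_closed X.face_closed map_face)
  with assms show ?thesis by blast
qed

text \<open>Induction on the degree: the induction hypothesis gives equality of the last faces, and
  \<open>eq_SucI\<close> then asks only for equal \<open>r\<close> and \<open>c\<close>.\<close>

lemma lift_unique:
  fixes W :: "('w, 'd) sset_scheme"
  assumes W: "simplicial_set W"
    and closed: "\<And>n w. w \<in> simplices W n \<Longrightarrow> F n w \<in> simplices Z n"
      "\<And>n w. w \<in> simplices W n \<Longrightarrow> F' n w \<in> simplices Z n"
    and last_face:
      "\<And>n w. w \<in> simplices W (Suc n) \<Longrightarrow>
        face Z (Suc n) (Suc n) (F (Suc n) w) = F n (face W (Suc n) (Suc n) w)"
      "\<And>n w. w \<in> simplices W (Suc n) \<Longrightarrow>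
        face Z (Suc n) (Suc n) (F' (Suc n) w) = F' n (face W (Suc n) (Suc n) w)"
    and r: "\<And>n w. w \<in> simplices W n \<Longrightarrow> r n (F n w) = r n (F' n w)"
    and c: "\<And>n w. w \<in> simplices W n \<Longrightarrow> c n (F n w) = c n (F' n w)"
    and w: "w \<in> simplices W n"
  shows "F n w = F' n w"
  using w
proof (induction n arbitrary: w)
  case 0
  show ?case by (rule eq_0I) (use 0 closed r c in auto)
next
  case (Suc n)
  show ?case
    by (rule eq_SucI)
      (use Suc closed r c last_face simplicial_set.face_closed[OF W Suc.prems, of "Suc n"] in auto)
qed

text \<open>Universal property: a map into \<open>Z\<close> is built from a map \<open>f\<close>
  into \<open>Y\<close> and a family \<open>d\<close> compatible with everything but last faces. In
  each degree the last face is prescribed by the degree below.\<close>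

lemma lift_exists:
  fixes W :: "('w, 'd) sset_scheme"
  assumes f: "simplicial_map W Y f"
    and d_closed: "\<And>n w. w \<in> simplices W n \<Longrightarrow> d n w \<in> simplices K n"
    and d_face: "\<And>n i w. \<lbrakk>w \<in> simplices W (Suc n); i \<le> n\<rbrakk> \<Longrightarrow>
      d n (face W (Suc n) i w) = face K (Suc n) i (d (Suc n) w)"
    and d_degen: "\<And>n i w. \<lbrakk>w \<in> simplices W n; i \<le> n\<rbrakk> \<Longrightarrow>
      d (Suc n) (degen W n i w) = degen K n i (d n w)"
  obtains F where "simplicial_map W Z F"
    and "\<And>n w. w \<in> simplices W n \<Longrightarrow> r n (F n w) = f n w"
    and "\<And>n w. w \<in> simplices W n \<Longrightarrow> c n (F n w) = d n w"
proof -
  interpret f: simplicial_map W Y f by fact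
  \<comment> \<open>Each \<open>THE\<close> is justified by \<open>ex1_0\<close> or
    \<open>ex1_Suc\<close>, the latter only once the degree below is known to lie over
    \<open>f\<close>; hence \<open>F_Suc\<close> carries hypotheses, discharged by the induction
    that proves \<open>F\<close>.\<close>
  define F where "F = rec_nat
    (\<lambda>w. THE z. z \<in> simplices Z 0 \<and> r 0 z = f 0 w \<and> c 0 z = d 0 w)
    (\<lambda>n F w. THE z. z \<in> simplices Z (Suc n) \<and> r (Suc n) z = f (Suc n) w \<and>
      c (Suc n) z = d (Suc n) w \<and> face Z (Suc n) (Suc n) z = F (face W (Suc n) (Suc n) w))"
  have F_0: "F 0 w \<in> simplices Z 0 \<and> r 0 (F 0 w) = f 0 w \<and> c 0 (F 0 w) = d 0 w"
    if "w \<in> simplices W 0" for w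
    using theI'[OF ex1_0[OF f.map_closed[OF that] d_closed[OF that]]] by (simp add: F_def)
  have F_Suc: "F (Suc n) w \<in> simplices Z (Suc n) \<and> r (Suc n) (F (Suc n) w) = f (Suc n) w \<and>
      c (Suc n) (F (Suc n) w) = d (Suc n) w \<and>
      face Z (Suc n) (Suc n) (F (Suc n) w) = F n (face W (Suc n) (Suc n) w)"
    if w: "w \<in> simplices W (Suc n)"
      and F: "F n (face W (Suc n) (Suc n) w) \<in> simplices Z n"
        "r n (F n (face W (Suc n) (Suc n) w)) = f n (face W (Suc n) (Suc n) w)" for n w
    using theI'[OF ex1_Suc[OF f.map_closed[OF w] d_closed[OF w] F(1)]] F(2) f.map_face[OF w, of "Suc n"]
    by (simp add: F_def)
  have F: "F n w \<in> simplices Z n \<and> r n (F n w) = f n w \<and> c n (F n w) = d n w"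
    if "w \<in> simplices W n" for n w
    using that
  proof (induction n arbitrary: w)
    case 0
    then show ?case by (rule F_0)
  next
    case (Suc n)
    then show ?case using F_Suc f.X.face_closed by blast
  qed
  have F_last: "face Z (Suc n) (Suc n) (F (Suc n) w) = F n (face W (Suc n) (Suc n) w)"
    if "w \<in> simplices W (Suc n)" for n w
    using F_Suc[OF that] F f.X.face_closed[OF that] by blast
  \<comment> \<open>For the last face this is the construction. For any other, both sides agree
    under \<open>r\<close> and \<open>c\<close>, so only their own last faces remain to be
    compared.\<close>
  have F_face: "F n (face W (Suc n) i w) = face Z (Suc n) i (F (Suc n) w)"
    if "w \<in> simplices W (Suc n)" "i \<le> Suc n" for n i w
    using that
  proof (induction n arbitrary: i w)
    case 0
    show ?case
    proof (cases "i = 1")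
      case True
      then show ?thesis using F_last[OF 0(1)] by simp
    next
      case False
      with 0 have "i = 0" by simp
      show ?thesis
        by (rule eq_0I)
          (use \<open>i = 0\<close> 0 F f.X.face_closed X.face_closed f.map_face map_face d_face c_face in auto)
    qed
  next
    case (Suc n)
    show ?case
    proof (cases "i = Suc (Suc n)")
      case True
      then show ?thesis using F_last[OF Suc.prems(1)] by simp
    next
      case False
      with Suc.prems have i: "i \<le> Suc n" by simp
      let ?d = "face W (Suc (Suc n))"
      have w': "?d i w \<in> simplices W (Suc n)" "?d (Suc (Suc n)) w \<in> simplices W (Suc n)"
        using Suc.prems by (auto intro: f.X.face_closed)
      \<comment> \<open>The identity d_(n+1) d_i = d_i d_(n+2) moves the last face inside, where the
        induction hypothesis applies one degree lower; the same identity in \<open>Z\<close> moves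
        it back out.\<close>
      have "face Z (Suc n) (Suc n) (F (Suc n) (?d i w)) = F n (face W (Suc n) (Suc n) (?d i w))"
        by (rule F_last[OF w'(1)])
      also have "\<dots> = F n (face W (Suc n) i (?d (Suc (Suc n)) w))"
        using f.X.face_face[OF Suc.prems(1), of i "Suc (Suc n)"] i by simp
      also have "\<dots> = face Z (Suc n) i (face Z (Suc (Suc n)) (Suc (Suc n)) (F (Suc (Suc n)) w))"
        using Suc.IH[OF w'(2) i] F_last[OF Suc.prems(1)] by simp
      also have "\<dots> = face Z (Suc n) (Suc n) (face Z (Suc (Suc n)) i (F (Suc (Suc n)) w))"
        using X.face_face[of "F (Suc (Suc n)) w" n i "Suc (Suc n)"] i F[OF Suc.prems(1)] by simp
      finally have last: "face Z (Suc n) (Suc n) (F (Suc n) (?d i w)) = \<dots>" .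
      show ?thesis
        by (rule eq_SucI)
          (use last Suc.prems i F w' X.face_closed f.map_face map_face d_face c_face in auto)
    qed
  qed
  have F_degen: "F (Suc n) (degen W n i w) = degen Z n i (F n w)"
    if "w \<in> simplices W n" "i \<le> n" for n i w
    using that
  proof (induction n arbitrary: i w)
    case 0
    then have w': "degen W 0 0 w \<in> simplices W (Suc 0)" by (auto intro: f.X.degen_closed)
    have last: "face Z (Suc 0) (Suc 0) (F (Suc 0) (degen W 0 0 w)) =
        face Z (Suc 0) (Suc 0) (degen Z 0 0 (F 0 w))"
      using F_last[OF w'] 0 F f.X.face_degen_same[of w 0 0 1] X.face_degen_same[of "F 0 w" 0 0 1]
      by simp
    show ?case
      by (rule eq_SucI)
        (use last 0 F w' X.degen_closed f.map_degen map_degen d_degen c_degen in auto)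
  next
    case (Suc n)
    let ?N = "Suc (Suc n)"
    have w': "degen W (Suc n) i w \<in> simplices W ?N"
      using Suc.prems by (auto intro: f.X.degen_closed)
    have last: "F (Suc n) (face W ?N ?N (degen W (Suc n) i w)) =
        face Z ?N ?N (degen Z (Suc n) i (F (Suc n) w))"
    \<comment> \<open>The last face undoes the last degeneracy and moves past every other one,
      leading to the induction hypothesis one degree lower.\<close>
    proof (cases "i = Suc n")
      case True
      then show ?thesis
        using f.X.face_degen_same[OF Suc.prems(1), of "Suc n" ?N] F[OF Suc.prems(1)]
          X.face_degen_same[of "F (Suc n) w" "Suc n" "Suc n" ?N] by simp
    next
      case False
      with Suc.prems have i: "i \<le> n" by simp
      have "F (Suc n) (face W ?N ?N (degen W (Suc n) i w)) =
          F (Suc n) (degen W n i (face W (Suc n) (Suc n) w))"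
        using f.X.face_degen_greater[OF Suc.prems(1), of i ?N] i by simp
      also have "\<dots> = degen Z n i (face Z (Suc n) (Suc n) (F (Suc n) w))"
        using Suc.IH[of "face W (Suc n) (Suc n) w" i] i F_last[OF Suc.prems(1)]
          f.X.face_closed[OF Suc.prems(1)] by simp
      also have "\<dots> = face Z ?N ?N (degen Z (Suc n) i (F (Suc n) w))"
        using X.face_degen_greater[of "F (Suc n) w" n i ?N] i F[OF Suc.prems(1)] by simp
      finally show ?thesis .
    qed
    show ?case
      by (rule eq_SucI)
        (use last Suc.prems F w' X.degen_closed f.map_degen map_degen d_degen c_degen F_last[OF w'] in auto)
  qed
  have "simplicial_map W Z F"
    using F F_face F_degen by unfold_locales auto
  then show thesis using that F by blast
qed

end

section \<open>Homotopies into cofree maps\<close>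

lemma simplicial_map_fst:
  assumes "simplicial_map X Y f" "simplicial_set W"
  shows "simplicial_map (prod_sset X W) Y (\<lambda>n. f n \<circ> fst)"
proof -
  interpret simplicial_map X Y f by fact
  interpret P: simplicial_set "prod_sset X W"
    by (rule simplicial_set_prod) (fact X.simplicial_set_axioms assms)+
  show ?thesis by unfold_locales (auto simp: map_closed map_face map_degen)
qed

lemma simplicial_map_id:
  assumes "simplicial_set X"
  shows "simplicial_map X X (\<lambda>n. id)"
  using assms by (simp add: simplicial_map_def simplicial_map_axioms_def)

text \<open>The constant homotopy: \<open>f\<close> after the projection.\<close>

lemma homotopicI_eq:
  assumes "simplicial_map X Y f" "\<And>n x. x \<in> simplices X n \<Longrightarrow> g n x = f n x"
  shows "homotopic X Y g f"
  unfolding homotopic_def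
  using simplicial_map_fst[OF assms(1) simplicial_set_interval] assms(2)
  by (intro exI[of _ "\<lambda>n. f n \<circ> fst"]) simp

text \<open>The point \<open>e\<close> of \<open>K\<close> makes the constant family at
  \<open>e\<close> an admissible \<open>d\<close> in \<open>lift_exists\<close>. Below it is the
  unit of \<open>G\<close>.\<close>

locale pointed_cofree_map = cofree_map Z Y r K c
  for Z :: "('z, 'a) sset_scheme" and Y :: "('y, 'b) sset_scheme" and r
    and K :: "('k, 'c) sset_scheme" and c +
  fixes e :: "nat \<Rightarrow> 'k"
  assumes e_closed: "e n \<in> simplices K n"
    and e_face: "i \<le> Suc n \<Longrightarrow> face K (Suc n) i (e (Suc n)) = e n"
    and e_degen: "i \<le> n \<Longrightarrow> degen K n i (e n) = e (Suc n)"
begin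

text \<open>
  At a simplex \<open>v\<close> of the interval, the homotopy keeps the coordinate \<open>c\<close> of the front faces
  ending in a vertex where \<open>v\<close> is \<open>1\<close> and replaces the others by the base point.
\<close>

lemma homotopic_section:
  assumes s: "simplicial_map Y Z s"
    and rs: "\<And>n y. y \<in> simplices Y n \<Longrightarrow> r n (s n y) = y"
    and cs: "\<And>n y. y \<in> simplices Y n \<Longrightarrow> c n (s n y) = e n"
  shows "homotopic Z Z (\<lambda>n. s n \<circ> r n) (\<lambda>n. id)"
proof -
  interpret s: simplicial_map Y Z s by fact
  let ?W = "prod_sset Z interval"
  obtain H where H: "simplicial_map ?W Z H"
    and rH: "\<And>n w. w \<in> simplices ?W n \<Longrightarrow> r n (H n w) = (r n \<circ> fst) w"
    and cH: "\<And>n w. w \<in> simplices ?W n \<Longrightarrow>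
      c n (H n w) = (if last (snd w) = 0 then e n else c n (fst w))"
    \<comment> \<open>Apart from the last faces, the structure maps of the interval preserve
      \<open>last\<close>, so they do not affect whether the coordinate is kept or reset to
      \<open>e\<close>.\<close>
    by (rule lift_exists[OF simplicial_map_fst[OF simplicial_map_axioms simplicial_set_interval],
          where d = "\<lambda>n w. if last (snd w) = 0 then e n else c n (fst w)"])
      (auto simp: e_closed c_closed e_face c_face e_degen c_degen last_interval)
  interpret H: simplicial_map ?W Z H by fact
  have v: "replicate (Suc n) a \<in> simplices interval n" if "a \<le> 1" for n and a :: nat
    using that by (auto simp: interval_simplices)
  \<comment> \<open>The last face of a constant simplex is constant, so both ends of
    \<open>H\<close> commute with last faces, as \<open>lift_unique\<close> requires.\<close>
  have face: "face Z (Suc n) (Suc n) (H (Suc n) (z, replicate (Suc (Suc n)) a)) =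
      H n (face Z (Suc n) (Suc n) z, replicate (Suc n) a)"
    if "z \<in> simplices Z (Suc n)" "a \<le> 1" for n z and a :: nat
    using H.map_face[of "(z, replicate (Suc (Suc n)) a)" n "Suc n"] that v[of a "Suc n"]
    by (simp add: interval_face_replicate del: replicate_Suc)
  \<comment> \<open>At the end 0 both maps have \<open>c\<close> equal to \<open>e n\<close>; at the
    end 1 both keep \<open>c n z\<close>.\<close>
  have "H n (z, replicate (Suc n) 0) = (s n \<circ> r n) z" if "z \<in> simplices Z n" for n z
    using that
    by (intro lift_unique[where F = "\<lambda>n z. H n (z, replicate (Suc n) 0)" and W = Z
          and F' = "\<lambda>n. s n \<circ> r n" and w = z])
      (auto simp: face H.map_closed s.map_closed map_closed v rH cH rs cs s.map_face map_face
        X.simplicial_set_axioms simp del: replicate_Suc)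
  moreover have "H n (z, replicate (Suc n) 1) = id z" if "z \<in> simplices Z n" for n z
    using that
    by (intro lift_unique[where F = "\<lambda>n z. H n (z, replicate (Suc n) 1)" and W = Z
          and F' = "\<lambda>n. id" and w = z])
      (auto simp: face H.map_closed v rH cH
        X.simplicial_set_axioms simp del: replicate_Suc)
  ultimately show ?thesis unfolding homotopic_def using H by blast
qed

lemma homotopy_equivalence_section:
  assumes s: "simplicial_map Y Z s"
    and rs: "\<And>n y. y \<in> simplices Y n \<Longrightarrow> r n (s n y) = y"
    and cs: "\<And>n y. y \<in> simplices Y n \<Longrightarrow> c n (s n y) = e n"
  shows "homotopy_equivalence Y Z s" and "homotopy_equivalence Z Y r"
proof -
  have "homotopic Y Y (\<lambda>n. r n \<circ> s n) (\<lambda>n. id)"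
    using simplicial_map_id[OF Y.simplicial_set_axioms] by (rule homotopicI_eq) (simp add: rs)
  then show "homotopy_equivalence Y Z s" "homotopy_equivalence Z Y r"
    unfolding homotopy_equivalence_def
    using s simplicial_map_axioms homotopic_section[OF assms] by blast+
qed

text \<open>The required section is the lift of the identity of \<open>Y\<close> with coordinate
  constantly \<open>e\<close>.\<close>

lemma homotopy_equivalence_retraction: "homotopy_equivalence Z Y r"
proof -
  obtain s where "simplicial_map Y Z s" "\<And>n y. y \<in> simplices Y n \<Longrightarrow> r n (s n y) = id y"
    "\<And>n y. y \<in> simplices Y n \<Longrightarrow> c n (s n y) = e n"
    by (rule lift_exists[OF simplicial_map_id[OF Y.simplicial_set_axioms], where d = "\<lambda>n y. e n"])
      (auto simp: e_closed e_face e_degen)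
  then show ?thesis using homotopy_equivalence_section(2) by simp
qed

end

section \<open>Simplicial groups and the classifying space\<close>

context simplicial_group
begin

section \<open>Group laws in each degree, preserved by the structure maps\<close>

abbreviation ginv :: "nat \<Rightarrow> 'g \<Rightarrow> 'g" where
  "ginv n g \<equiv> inv\<^bsub>grp G n\<^esub> g"

lemma grp_sel [simp]:
  "carrier (grp G n) = simplices G n" "mult (grp G n) = gmult G n" "one (grp G n) = gone G n"
  by (simp_all add: grp_def)

lemma gone_closed [simp]: "gone G n \<in> simplices G n"
  using group.is_monoid[OF group_grp, THEN monoid.one_closed, of n] by simp

lemma gmult_closed [simp]:
  "\<lbrakk>a \<in> simplices G n; b \<in> simplices G n\<rbrakk> \<Longrightarrow> gmult G n a b \<in> simplices G n"
  using group.is_monoid[OF group_grp, THEN monoid.m_closed, of a n b] by simp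

lemma ginv_closed [simp]: "a \<in> simplices G n \<Longrightarrow> ginv n a \<in> simplices G n"
  using group.inv_closed[OF group_grp, of a n] by simp

lemma gmult_assoc:
  "\<lbrakk>a \<in> simplices G n; b \<in> simplices G n; d \<in> simplices G n\<rbrakk> \<Longrightarrow>
    gmult G n (gmult G n a b) d = gmult G n a (gmult G n b d)"
  using group.is_monoid[OF group_grp, THEN monoid.m_assoc, of a n b d] by simp

lemma gmult_one [simp]:
  "a \<in> simplices G n \<Longrightarrow> gmult G n a (gone G n) = a"
  "a \<in> simplices G n \<Longrightarrow> gmult G n (gone G n) a = a"
  using group.is_monoid[OF group_grp, THEN monoid.r_one, of a n]
    group.is_monoid[OF group_grp, THEN monoid.l_one, of a n] by simp_all

lemma ginv_cancel [simp]:
  assumes "a \<in> simplices G n"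
  shows "gmult G n a (ginv n a) = gone G n" "gmult G n (ginv n a) a = gone G n"
  using group.r_inv[OF group_grp, of a n] group.l_inv[OF group_grp, of a n] assms by simp_all

lemma ginv_cancel_left [simp]:
  assumes "a \<in> simplices G n" "b \<in> simplices G n"
  shows "gmult G n (ginv n a) (gmult G n a b) = b"
  using assms by (simp flip: gmult_assoc)

lemma ginv_ginv [simp]: "a \<in> simplices G n \<Longrightarrow> ginv n (ginv n a) = a"
  using group.inv_inv[OF group_grp, of a n] by simp

lemma ginv_gone [simp]: "ginv n (gone G n) = gone G n"
  using group.is_monoid[OF group_grp, THEN monoid.inv_one, of n] by simp

lemma ginv_gmult:
  "\<lbrakk>a \<in> simplices G n; b \<in> simplices G n\<rbrakk> \<Longrightarrow>
    ginv n (gmult G n a b) = gmult G n (ginv n b) (ginv n a)"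
  using group.inv_mult_group[OF group_grp, of a n b] by simp

lemma group_hom_face: "i \<le> Suc n \<Longrightarrow> group_hom (grp G (Suc n)) (grp G n) (face G (Suc n) i)"
  by (simp add: group_hom_def group_hom_axioms_def group_grp face_hom)

lemma group_hom_degen: "i \<le> n \<Longrightarrow> group_hom (grp G n) (grp G (Suc n)) (degen G n i)"
  by (simp add: group_hom_def group_hom_axioms_def group_grp degen_hom)

lemma face_gmult:
  "\<lbrakk>i \<le> Suc n; a \<in> simplices G (Suc n); b \<in> simplices G (Suc n)\<rbrakk> \<Longrightarrow>
    face G (Suc n) i (gmult G (Suc n) a b) = gmult G n (face G (Suc n) i a) (face G (Suc n) i b)"
  using group_hom.hom_mult[OF group_hom_face, of i n a b] by simp

lemma degen_gmult:
  "\<lbrakk>i \<le> n; a \<in> simplices G n; b \<in> simplices G n\<rbrakk> \<Longrightarrow>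
    degen G n i (gmult G n a b) = gmult G (Suc n) (degen G n i a) (degen G n i b)"
  using group_hom.hom_mult[OF group_hom_degen, of i n a b] by simp

lemma face_gone: "i \<le> Suc n \<Longrightarrow> face G (Suc n) i (gone G (Suc n)) = gone G n"
  using group_hom.hom_one[OF group_hom_face, of i n] by simp

lemma degen_gone: "i \<le> n \<Longrightarrow> degen G n i (gone G n) = gone G (Suc n)"
  using group_hom.hom_one[OF group_hom_degen, of i n] by simp

lemma face_ginv:
  "\<lbrakk>i \<le> Suc n; a \<in> simplices G (Suc n)\<rbrakk> \<Longrightarrow>
    face G (Suc n) i (ginv (Suc n) a) = ginv n (face G (Suc n) i a)"
  using group_hom.hom_inv[OF group_hom_face, of i n a] by simp

lemma degen_ginv:
  "\<lbrakk>i \<le> n; a \<in> simplices G n\<rbrakk> \<Longrightarrow>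
    degen G n i (ginv n a) = ginv (Suc n) (degen G n i a)"
  using group_hom.hom_inv[OF group_hom_degen, of i n a] by simp

section \<open>The classifying space\<close>

lemma BG_simplices: "b \<in> simplices (BG G) n \<longleftrightarrow> length b = n \<and> (\<forall>k<n. b ! k \<in> simplices G k)"
  by (simp add: BG_def)

lemma length_BG_face [simp]: "length (face (BG G) n i b) = n - 1"
  by (simp add: BG_def)

lemma length_BG_degen [simp]: "length (degen (BG G) n i b) = Suc n"
  by (simp add: BG_def)

lemma nth_BG_face:
  "k < n \<Longrightarrow> face (BG G) (Suc n) i b ! k =
    (if Suc k < i then b ! k
     else if Suc k = i then gmult G k (b ! k) (face G (Suc k) i (b ! Suc k))
     else face G (Suc k) i (b ! Suc k))"
  by (auto simp: BG_def)

lemma nth_BG_degen: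
  "k < Suc n \<Longrightarrow> degen (BG G) n i b ! k =
    (if k < i then b ! k else if k = i then gone G k else degen G (k - 1) i (b ! (k - 1)))"
  by (auto simp: BG_def simp del: upt_Suc)

lemma simplicial_set_BG: "simplicial_set (BG G)"
proof
  fix b n i
  assume "b \<in> simplices (BG G) (Suc n)" "i \<le> Suc n"
  then show "face (BG G) (Suc n) i b \<in> simplices (BG G) n"
    by (auto simp: BG_simplices nth_BG_face intro!: gmult_closed face_closed)
next
  fix b n i
  assume b: "b \<in> simplices (BG G) n" "i \<le> n"
  show "degen (BG G) n i b \<in> simplices (BG G) (Suc n)"
    unfolding BG_simplices
  proof (intro conjI allI impI)
    fix k assume "k < Suc n"
    with b show "degen (BG G) n i b ! k \<in> simplices G k"
      by (cases k) (auto simp: BG_simplices nth_BG_degen intro!: degen_closed)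
  qed simp
next
  fix b n i j
  assume b: "b \<in> simplices (BG G) (Suc (Suc n))" and ij: "i < j" "j \<le> Suc (Suc n)"
  show "face (BG G) (Suc n) i (face (BG G) (Suc (Suc n)) j b) =
      face (BG G) (Suc n) (j - 1) (face (BG G) (Suc (Suc n)) i b)"
  proof (rule nth_equalityI)
    fix k assume "k < length (face (BG G) (Suc n) i (face (BG G) (Suc (Suc n)) j b))"
    then have k: "k < n" by simp
    then have bk: "b ! k \<in> simplices G k" "b ! Suc k \<in> simplices G (Suc k)"
        "b ! Suc (Suc k) \<in> simplices G (Suc (Suc k))"
      using b by (auto simp: BG_simplices)
    \<comment> \<open>Entry \<open>k\<close> of either side depends only on entries \<open>k\<close>
      to \<open>k + 2\<close> of \<open>b\<close>. Associativity enters when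
      \<open>i = k + 1\<close> and \<open>j = k + 2\<close>, where all three are multiplied
      together.\<close>
    consider "j < Suc k" | "j = Suc k" | "j = Suc (Suc k)" | "j > Suc (Suc k)" by linarith
    then show "face (BG G) (Suc n) i (face (BG G) (Suc (Suc n)) j b) ! k =
        face (BG G) (Suc n) (j - 1) (face (BG G) (Suc (Suc n)) i b) ! k"
      by cases (use k bk ij face_face[OF bk(3), of i j] in
          \<open>auto simp: nth_BG_face face_gmult gmult_assoc face_closed\<close>)
  qed simp
next
  fix b n i j
  assume b: "b \<in> simplices (BG G) n" and ij: "i \<le> j" "j \<le> n"
  show "degen (BG G) (Suc n) i (degen (BG G) n j b) =
      degen (BG G) (Suc n) (Suc j) (degen (BG G) n i b)"
  proof (rule nth_equalityI)
    fix k assume "k < length (degen (BG G) (Suc n) i (degen (BG G) n j b))"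
    then have k: "k < Suc (Suc n)" by simp
    \<comment> \<open>From position 2 on, an entry may have been shifted twice; then
      \<open>degen_degen\<close> in \<open>G\<close> is applied to entry
      \<open>k - 2\<close>.\<close>
    consider "k = 0" | "k = 1" | l where "k = Suc (Suc l)" by (metis One_nat_def not0_implies_Suc)
    then show "degen (BG G) (Suc n) i (degen (BG G) n j b) ! k =
        degen (BG G) (Suc n) (Suc j) (degen (BG G) n i b) ! k"
    proof cases
      case 3
      then have "b ! l \<in> simplices G l" using b k by (auto simp: BG_simplices)
      with 3 k ij degen_degen[of "b ! l" l i j] show ?thesis
        by (auto simp: nth_BG_degen degen_gone)
    qed (use k ij in \<open>auto simp: nth_BG_degen degen_gone\<close>)
  qed simp
next
  fix b n i j
  assume b: "b \<in> simplices (BG G) (Suc n)" and ij: "i < j" "j \<le> Suc n"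
  show "face (BG G) (Suc (Suc n)) i (degen (BG G) (Suc n) j b) =
      degen (BG G) n (j - 1) (face (BG G) (Suc n) i b)"
  proof (rule nth_equalityI)
    fix k assume "k < length (face (BG G) (Suc (Suc n)) i (degen (BG G) (Suc n) j b))"
    then have k: "k < Suc n" by simp
    then have bk: "b ! k \<in> simplices G k" using b by (auto simp: BG_simplices)
    show "face (BG G) (Suc (Suc n)) i (degen (BG G) (Suc n) j b) ! k =
        degen (BG G) n (j - 1) (face (BG G) (Suc n) i b) ! k"
    proof (cases k)
      case 0
      with k bk ij show ?thesis
        by (auto simp: nth_BG_face nth_BG_degen face_gone)
    next
      case (Suc l)
      have "b ! l \<in> simplices G l" using b k Suc by (auto simp: BG_simplices)
      with Suc k bk ij face_degen_less[of "b ! k" l i j] show ?thesis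
        by (auto simp: nth_BG_face nth_BG_degen face_gone degen_gmult face_closed)
    qed
  qed simp
next
  fix b n i j
  assume b: "b \<in> simplices (BG G) n" and ij: "j \<le> n" "i = j \<or> i = Suc j"
  show "face (BG G) (Suc n) i (degen (BG G) n j b) = b"
  proof (rule nth_equalityI)
    fix k assume "k < length (face (BG G) (Suc n) i (degen (BG G) n j b))"
    then have k: "k < n" by simp
    then have bk: "b ! k \<in> simplices G k" using b by (auto simp: BG_simplices)
    show "face (BG G) (Suc n) i (degen (BG G) n j b) ! k = b ! k"
      using k bk ij face_degen_same[OF bk, of j i]
      by (auto simp: nth_BG_face nth_BG_degen face_gone)
  qed (use b in \<open>simp add: BG_simplices\<close>)
next
  fix b n i j
  assume b: "b \<in> simplices (BG G) (Suc n)" and ij: "Suc j < i" "i \<le> Suc (Suc n)"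
  from ij obtain m where i: "i = Suc m" by (cases i) auto
  show "face (BG G) (Suc (Suc n)) i (degen (BG G) (Suc n) j b) =
      degen (BG G) n j (face (BG G) (Suc n) (i - 1) b)"
  proof (rule nth_equalityI)
    fix k assume "k < length (face (BG G) (Suc (Suc n)) i (degen (BG G) (Suc n) j b))"
    then have k: "k < Suc n" by simp
    then have bk: "b ! k \<in> simplices G k" using b by (auto simp: BG_simplices)
    show "face (BG G) (Suc (Suc n)) i (degen (BG G) (Suc n) j b) ! k =
        degen (BG G) n j (face (BG G) (Suc n) (i - 1) b) ! k"
    proof (cases k)
      case 0
      with k bk ij show ?thesis
        by (auto simp: nth_BG_face nth_BG_degen face_gone)
    next
      case (Suc l)
      have "b ! l \<in> simplices G l" using b k Suc by (auto simp: BG_simplices)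
      with Suc k bk ij i face_degen_greater[of "b ! k" l j i] show ?thesis
        by (auto simp: nth_BG_face nth_BG_degen face_gone degen_gmult face_closed)
    qed
  qed simp
qed

lemma tau_BG_nth: "b \<in> simplices (BG G) (Suc n) \<Longrightarrow> tau_BG b = b ! n"
  by (metis BG_simplices tau_BG_def diff_Suc_1 last_conv_nth length_0_conv nat.distinct(1))

lemma tau_BG_face: "tau_BG (face (BG G) (Suc (Suc n)) i b) = face (BG G) (Suc (Suc n)) i b ! n"
  by (metis diff_Suc_1 last_conv_nth length_0_conv length_BG_face nat.distinct(1) tau_BG_def)

lemma tau_BG_degen: "tau_BG (degen (BG G) n i b) = degen (BG G) n i b ! n"
  by (metis diff_Suc_1 last_conv_nth length_0_conv length_BG_degen nat.distinct(1) tau_BG_def)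

text \<open>For the last index the position of the product lies beyond the end of the list.\<close>

lemma BG_last_face:
  assumes "b \<in> simplices (BG G) (Suc n)"
  shows "face (BG G) (Suc n) (Suc n) b = butlast b"
  by (rule nth_equalityI) (use assms in \<open>auto simp: BG_simplices nth_BG_face nth_butlast\<close>)

text \<open>The fibre that exhibits \<open>h_space\<close> as a twisted product: the twist
  multiplies from the left, and the action from the right is added afterwards.\<close>

lemma left_gspace_self:
  "left_gspace G \<lparr>simplices = simplices G, face = face G, degen = degen G, act = gmult G\<rparr>"
proof -
  interpret S: simplicial_set "\<lparr>simplices = simplices G, face = face G, degen = degen G, act = gmult G\<rparr>"
    by (rule simplicial_set_cong[OF simplicial_set_axioms]) simp_all
  show ?thesis
    by unfold_locales (simp_all add: gmult_assoc face_gmult degen_gmult)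
qed

end

section \<open>Twisted products\<close>

text \<open>The laws of a twisting function, for twisted last faces. Both \<open>t_space\<close> and
  \<open>h_space\<close> are instances, so the simplicial identities are checked once.\<close>

locale twisted_product = B: simplicial_set B + left_gspace G F
  for G :: "'g sgroup" and B :: "('b, 'z) sset_scheme" and F :: "('x, 'g) gspace" +
  fixes tau :: "nat \<Rightarrow> 'b \<Rightarrow> 'g"
  assumes tau_closed: "b \<in> simplices B (Suc n) \<Longrightarrow> tau (Suc n) b \<in> simplices G n"
    and tau_face:
      "\<lbrakk>b \<in> simplices B (Suc (Suc n)); i \<le> n\<rbrakk> \<Longrightarrow>
        tau (Suc n) (face B (Suc (Suc n)) i b) = face G (Suc n) i (tau (Suc (Suc n)) b)"
    and tau_last_face:
      "b \<in> simplices B (Suc (Suc n)) \<Longrightarrow>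
        tau (Suc n) (face B (Suc (Suc n)) (Suc n) b) =
        gmult G n (tau (Suc n) (face B (Suc (Suc n)) (Suc (Suc n)) b))
          (face G (Suc n) (Suc n) (tau (Suc (Suc n)) b))"
    and tau_degen:
      "\<lbrakk>b \<in> simplices B (Suc n); i \<le> n\<rbrakk> \<Longrightarrow>
        tau (Suc (Suc n)) (degen B (Suc n) i b) = degen G n i (tau (Suc n) b)"
    and tau_last_degen:
      "b \<in> simplices B n \<Longrightarrow> tau (Suc n) (degen B n n b) = gone G n"
begin

definition twisted :: "('b \<times> 'x) sset" where
  "twisted =
    \<lparr>simplices = (\<lambda>n. simplices B n \<times> simplices F n),
     face = (\<lambda>n i (b, x).
       (face B n i b, if i = n then act F (n - 1) (tau n b) (face F n i x) else face F n i x)),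
     degen = (\<lambda>n i (b, x). (degen B n i b, degen F n i x))\<rparr>"

lemma twisted_sel [simp]:
  "simplices twisted n = simplices B n \<times> simplices F n"
  "face twisted (Suc n) i (b, x) =
    (face B (Suc n) i b,
     if i = Suc n then act F n (tau (Suc n) b) (face F (Suc n) i x) else face F (Suc n) i x)"
  "degen twisted n i (b, x) = (degen B n i b, degen F n i x)"
  by (simp_all add: twisted_def)

lemma simplicial_set_twisted: "simplicial_set twisted"
proof
  fix z n i
  assume "z \<in> simplices twisted (Suc n)" "i \<le> Suc n"
  then show "face twisted (Suc n) i z \<in> simplices twisted n"
    by (auto simp: B.face_closed X.face_closed tau_closed act_closed)
next
  fix z n i
  assume "z \<in> simplices twisted n" "i \<le> n"
  then show "degen twisted n i z \<in> simplices twisted (Suc n)"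
    by (auto simp: B.degen_closed X.degen_closed)
next
  fix z n i j
  assume z: "z \<in> simplices twisted (Suc (Suc n))" and ij: "i < j" "j \<le> Suc (Suc n)"
  obtain b x where [simp]: "z = (b, x)" by force
  have b: "b \<in> simplices B (Suc (Suc n))" and x: "x \<in> simplices F (Suc (Suc n))"
    using z by auto
  note facts = B.face_closed[OF b] X.face_closed[OF x]
    tau_closed tau_face[OF b] tau_last_face[OF b] act_face act_mult G.face_closed X.face_closed
  \<comment> \<open>In the first case no twisted face occurs. The second rests on
    \<open>tau_face\<close>, the third on \<open>tau_last_face\<close>, the law that reconciles two
    successive twists with a single one.\<close>
  consider "j < Suc (Suc n)" | "j = Suc (Suc n)" "i < Suc n" | "j = Suc (Suc n)" "i = Suc n"
    using ij by linarith
  then show "face twisted (Suc n) i (face twisted (Suc (Suc n)) j z) =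
      face twisted (Suc n) (j - 1) (face twisted (Suc (Suc n)) i z)"
  proof cases
    case 1
    then show ?thesis using ij by (auto simp: B.face_face[OF b ij] X.face_face[OF x ij])
  next
    case 2
    then show ?thesis
      using b x B.face_face[OF b, of i "Suc (Suc n)"] X.face_face[OF x, of i "Suc (Suc n)"]
      by (simp add: facts)
  next
    case 3
    then show ?thesis
      using b x B.face_face[OF b, of "Suc n" "Suc (Suc n)"]
        X.face_face[OF x, of "Suc n" "Suc (Suc n)"]
      by (simp add: facts)
  qed
next
  fix z n i j
  assume "z \<in> simplices twisted n" "i \<le> j" "j \<le> n"
  then show "degen twisted (Suc n) i (degen twisted n j z) =
      degen twisted (Suc n) (Suc j) (degen twisted n i z)"
    by (auto simp: B.degen_degen X.degen_degen)
next
  fix z n i j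
  assume "z \<in> simplices twisted (Suc n)" "i < j" "j \<le> Suc n"
  then show "face twisted (Suc (Suc n)) i (degen twisted (Suc n) j z) =
      degen twisted n (j - 1) (face twisted (Suc n) i z)"
    by (auto simp: B.face_degen_less X.face_degen_less)
next
  fix z n i j
  assume "z \<in> simplices twisted n" "j \<le> n" "i = j \<or> i = Suc j"
  then show "face twisted (Suc n) i (degen twisted n j z) = z"
    by (auto simp: B.face_degen_same X.face_degen_same tau_last_degen act_one)
next
  fix z n i j
  assume "z \<in> simplices twisted (Suc n)" "Suc j < i" "i \<le> Suc (Suc n)"
  then show "face twisted (Suc (Suc n)) i (degen twisted (Suc n) j z) =
      degen twisted n j (face twisted (Suc n) (i - 1) z)"
    by (auto simp: B.face_degen_greater X.face_degen_greater tau_degen act_degen tau_closed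
        X.face_closed)
qed

end

text \<open>The laws for \<open>tau\<close> are read off the last entries of faces and degeneracies
  in \<open>BG G\<close> and pulled back along the simplicial map \<open>proj Y\<close>.\<close>

lemma (in simplicial_group) twisted_product_BG:
  assumes Y: "space_over (BG G) Y" and X: "left_gspace G X"
  shows "twisted_product G Y X (\<lambda>n y. tau_BG (proj Y n y))"
proof -
  interpret Y: space_over "BG G" Y by fact
  interpret X: left_gspace G X by fact
  have mem: "proj Y n y ! k \<in> simplices G k" if "y \<in> simplices Y n" "k < n" for n y k
    using Y.map_closed[OF that(1)] that(2) by (simp add: BG_simplices)
  have tau: "tau_BG (proj Y (Suc n) y) = proj Y (Suc n) y ! n" if "y \<in> simplices Y (Suc n)" for n y
    using Y.map_closed[OF that] by (rule tau_BG_nth)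
  show ?thesis
    by unfold_locales
      (simp_all add: tau mem tau_BG_face tau_BG_degen Y.map_face Y.map_degen
        nth_BG_face nth_BG_degen)
qed

section \<open>The functors t and h\<close>

context simplicial_group
begin

lemma t_space_sel [simp]:
  "simplices (t_space G X) n = simplices (BG G) n \<times> simplices X n"
  "face (t_space G X) (Suc n) i (b, x) =
    (face (BG G) (Suc n) i b,
     if i = Suc n then act X n (tau_BG b) (face X (Suc n) i x) else face X (Suc n) i x)"
  "degen (t_space G X) n i (b, x) = (degen (BG G) n i b, degen X n i x)"
  "proj (t_space G X) n (b, x) = b"
  by (simp_all add: t_space_def)

lemma h_space_sel [simp]:
  "simplices (h_space G Y) n = simplices Y n \<times> simplices G n"
  "face (h_space G Y) (Suc n) i (y, g) =
    (face Y (Suc n) i y,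
     if i = Suc n then gmult G n (tau_BG (proj Y (Suc n) y)) (face G (Suc n) i g)
     else face G (Suc n) i g)"
  "degen (h_space G Y) n i (y, g) = (degen Y n i y, degen G n i g)"
  "act (h_space G Y) n h (y, g) = (y, gmult G n g (ginv n h))"
  by (simp_all add: h_space_def)

text \<open>With \<open>BG G\<close> as its own space over the base,
  \<open>twisted_product_BG\<close> also covers \<open>t_space\<close>.\<close>

lemma space_over_self:
  "space_over (BG G)
    \<lparr>simplices = simplices (BG G), face = face (BG G), degen = degen (BG G), proj = (\<lambda>n b. b)\<rparr>"
  using simplicial_set_BG
  by (simp add: space_over_def simplicial_map_def simplicial_map_axioms_def simplicial_set_def)

lemma tau_BG_closed: "b \<in> simplices (BG G) (Suc n) \<Longrightarrow> tau_BG b \<in> simplices G n"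
  by (simp add: tau_BG_nth) (simp add: BG_simplices)

lemma space_over_t_space:
  assumes X: "left_gspace G X"
  shows "space_over (BG G) (t_space G X)"
proof -
  interpret BG: simplicial_set "BG G" by (rule simplicial_set_BG)
  let ?B = "\<lparr>simplices = simplices (BG G), face = face (BG G), degen = degen (BG G),
    proj = (\<lambda>n b :: 'g list. b)\<rparr>"
  interpret T: twisted_product G ?B X "\<lambda>n b. tau_BG (proj ?B n b)"
    by (rule twisted_product_BG[OF space_over_self X])
  interpret t: simplicial_set "t_space G X"
    by (rule simplicial_set_cong[OF T.simplicial_set_twisted])
      (unfold t_space_def T.twisted_def, simp_all cong: if_cong)
  show ?thesis by unfold_locales auto
qed

lemma left_gspace_h_space:
  assumes Y: "space_over (BG G) Y"
  shows "left_gspace G (h_space G Y)"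
proof -
  interpret Y: space_over "BG G" Y by fact
  let ?F = "\<lparr>simplices = simplices G, face = face G, degen = degen G, act = gmult G\<rparr>"
  interpret T: twisted_product G Y ?F "\<lambda>n y. tau_BG (proj Y n y)"
    by (rule twisted_product_BG[OF Y left_gspace_self])
  interpret h: simplicial_set "h_space G Y"
    by (rule simplicial_set_cong[OF T.simplicial_set_twisted])
      (simp_all add: h_space_def T.twisted_def cong: if_cong)
  \<comment> \<open>The action multiplies from the right, so by associativity it is compatible with
    the left twist in the last face.\<close>
  show ?thesis
    by unfold_locales
      (auto simp: gmult_assoc ginv_gmult face_gmult face_ginv degen_gmult degen_ginv face_closed
        tau_BG_closed Y.map_closed)
qed

text \<open>With \<open>BG_Suc_eqI\<close>: a simplex of positive degree is freely given by its last
  face and its \<open>tau_BG\<close>. This yields existence and uniqueness in the cofree structures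
  below.\<close>

lemma BG_snoc:
  assumes "b \<in> simplices (BG G) n" "a \<in> simplices G n"
  shows "b @ [a] \<in> simplices (BG G) (Suc n)"
    and "face (BG G) (Suc n) (Suc n) (b @ [a]) = b" and "tau_BG (b @ [a]) = a"
proof -
  show "b @ [a] \<in> simplices (BG G) (Suc n)"
    using assms by (auto simp: BG_simplices nth_append less_Suc_eq)
  then show "face (BG G) (Suc n) (Suc n) (b @ [a]) = b" by (simp add: BG_last_face)
qed (simp add: tau_BG_def)

lemma BG_Suc_eqI:
  assumes "b \<in> simplices (BG G) (Suc n)" "b' \<in> simplices (BG G) (Suc n)"
    and "face (BG G) (Suc n) (Suc n) b = face (BG G) (Suc n) (Suc n) b'" "tau_BG b = tau_BG b'"
  shows "b = b'"
proof -
  have "b \<noteq> []" "b' \<noteq> []" using assms by (auto simp: BG_simplices)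
  then show ?thesis
    using assms by (metis BG_last_face append_butlast_last_id tau_BG_def)
qed

section \<open>P and I as morphisms\<close>

lemma gspace_map_P_map:
  assumes X: "left_gspace G X"
  shows "gspace_map G (h_space G (t_space G X)) X (P_map G X)"
proof -
  interpret X: left_gspace G X by fact
  interpret h: left_gspace G "h_space G (t_space G X)"
    by (rule left_gspace_h_space[OF space_over_t_space[OF X]])
  \<comment> \<open>In the last face both \<open>x\<close> and \<open>g\<close> acquire the factor
    \<open>tau_BG b\<close> on the left, which cancels in the inverse of \<open>g\<close> applied to
    \<open>x\<close>.\<close>
  show ?thesis
    by unfold_locales
      (auto simp: P_map_def X.act_closed X.act_face X.act_degen ginv_gmult face_ginv degen_ginv
        X.X.face_closed face_closed tau_BG_closed gmult_assoc simp flip: X.act_mult)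
qed

lemma space_over_map_I_map:
  assumes Y: "space_over (BG G) Y"
  shows "space_over_map (BG G) Y (t_space G (h_space G Y)) (I_map G Y)"
proof -
  interpret Y: space_over "BG G" Y by fact
  interpret t: space_over "BG G" "t_space G (h_space G Y)"
    by (rule space_over_t_space[OF left_gspace_h_space[OF Y]])
  \<comment> \<open>In the last face of I(y) the unit is multiplied by
    \<open>tau_BG (proj Y n y)\<close> on the left, from \<open>h_space\<close>, and by its inverse
    on the right, from the action in \<open>t_space\<close>.\<close>
  show ?thesis
    by unfold_locales
      (auto simp: I_map_def Y.map_closed Y.map_face Y.map_degen face_gone degen_gone tau_BG_closed)
qed

section \<open>Cofree structures on P and on the projection to Y\<close>

lemma pointed_cofree_map_P_map:
  assumes X: "left_gspace G X"
  shows "pointed_cofree_map (h_space G (t_space G X)) X (P_map G X) G (\<lambda>n. snd) (gone G)"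
proof -
  interpret X: left_gspace G X by fact
  interpret P: gspace_map G "h_space G (t_space G X)" X "P_map G X"
    by (rule gspace_map_P_map[OF X])
  show ?thesis
  proof unfold_locales
    fix x g assume x: "x \<in> simplices X 0" and g: "g \<in> simplices G 0"
    show "\<exists>!z. z \<in> simplices (h_space G (t_space G X)) 0 \<and> P_map G X 0 z = x \<and> snd z = g"
    \<comment> \<open>In degree 0 the list is empty, and the value \<open>x\<close> of P forces the
      second component to be \<open>g\<close> applied to \<open>x\<close>.\<close>
    proof (rule ex1I[of _ "(([], act X 0 g x), g)"])
      show "z = (([], act X 0 g x), g)"
        if "z \<in> simplices (h_space G (t_space G X)) 0 \<and> P_map G X 0 z = x \<and> snd z = g" for z
        using that g by (auto simp: P_map_def BG_simplices X.act_one simp flip: X.act_mult)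
    qed (use x g in \<open>auto simp: P_map_def BG_simplices X.act_closed X.act_one simp flip: X.act_mult\<close>)
  next
    fix x n g z
    assume x: "x \<in> simplices X (Suc n)" and g: "g \<in> simplices G (Suc n)"
      and z: "z \<in> simplices (h_space G (t_space G X)) n"
      and eq: "P_map G X n z = face X (Suc n) (Suc n) x"
    obtain b' x' g' where z_eq: "z = ((b', x'), g')" by (metis surj_pair)
    have b': "b' \<in> simplices (BG G) n" and x': "x' \<in> simplices X n" and g': "g' \<in> simplices G n"
      using z by (auto simp: z_eq)
    have x'_eq: "x' = act X n g' (face X (Suc n) (Suc n) x)"
      using eq x' g' by (auto simp: z_eq P_map_def X.act_one simp flip: X.act_mult eq)
    define dg where "dg = face G (Suc n) (Suc n) g"
    have dg: "dg \<in> simplices G n" using g by (simp add: dg_def face_closed)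
    \<comment> \<open>The new list entry must solve \<open>gmult G n a dg = g'\<close>. The
      component \<open>x'\<close> then comes out right by \<open>x'_eq\<close>.\<close>
    define a where "a = gmult G n g' (ginv n dg)"
    have a: "a \<in> simplices G n" using dg g' by (simp add: a_def)
    show "\<exists>!u. u \<in> simplices (h_space G (t_space G X)) (Suc n) \<and> P_map G X (Suc n) u = x \<and>
      snd u = g \<and> face (h_space G (t_space G X)) (Suc n) (Suc n) u = z"
    proof (rule ex1I[of _ "((b' @ [a], act X (Suc n) g x), g)"])
      have "act X n a (act X n dg (face X (Suc n) (Suc n) x)) = x'"
        using x g' dg by (simp add: x'_eq a_def X.X.face_closed gmult_assoc flip: X.act_mult)
      moreover have "gmult G n a dg = g'"
        using g' dg by (simp add: a_def gmult_assoc)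
      ultimately show "((b' @ [a], act X (Suc n) g x), g) \<in> simplices (h_space G (t_space G X)) (Suc n) \<and>
        P_map G X (Suc n) ((b' @ [a], act X (Suc n) g x), g) = x \<and>
        snd ((b' @ [a], act X (Suc n) g x), g) = g \<and>
        face (h_space G (t_space G X)) (Suc n) (Suc n) ((b' @ [a], act X (Suc n) g x), g) = z"
        using x g BG_snoc[OF b' a]
        by (simp add: P_map_def X.act_closed X.act_one X.act_face z_eq flip: X.act_mult dg_def)
    next
      fix u
      assume u: "u \<in> simplices (h_space G (t_space G X)) (Suc n) \<and> P_map G X (Suc n) u = x \<and>
        snd u = g \<and> face (h_space G (t_space G X)) (Suc n) (Suc n) u = z"
      then obtain b x1 where u_eq: "u = ((b, x1), g)" by (metis surj_pair snd_conv)
      have b: "b \<in> simplices (BG G) (Suc n)" and x1: "x1 \<in> simplices X (Suc n)"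
        and db: "face (BG G) (Suc n) (Suc n) b = b'" and tau: "gmult G n (tau_BG b) dg = g'"
        and x_eq: "x = act X (Suc n) (ginv (Suc n) g) x1"
        using u by (auto simp: u_eq z_eq dg_def P_map_def)
      have "tau_BG b = a"
        using tau_BG_closed[OF b] dg by (simp add: a_def gmult_assoc flip: tau)
      then have "b = b' @ [a]"
        using BG_snoc[OF b' a] db by (intro BG_Suc_eqI[OF b]) simp_all
      moreover have "x1 = act X (Suc n) g x"
        using g x1 by (simp add: x_eq X.act_one flip: X.act_mult)
      ultimately show "u = ((b' @ [a], act X (Suc n) g x), g)" by (simp add: u_eq)
    qed
  qed (auto simp: face_gone degen_gone)
qed

lemma pointed_cofree_map_projection:
  assumes Y: "space_over (BG G) Y"
  shows "pointed_cofree_map (t_space G (h_space G Y)) Y (\<lambda>n. fst \<circ> snd) G (\<lambda>n. snd \<circ> snd) (gone G)"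
proof -
  interpret Y: space_over "BG G" Y by fact
  interpret t: space_over "BG G" "t_space G (h_space G Y)"
    by (rule space_over_t_space[OF left_gspace_h_space[OF Y]])
  show ?thesis
  proof unfold_locales
    fix y g assume y: "y \<in> simplices Y 0" and g: "g \<in> simplices G 0"
    show "\<exists>!z. z \<in> simplices (t_space G (h_space G Y)) 0 \<and> (fst \<circ> snd) z = y \<and> (snd \<circ> snd) z = g"
      by (rule ex1I[of _ "([], (y, g))"]) (use y g in \<open>auto simp: BG_simplices\<close>)
  next
    fix y n g z
    assume y: "y \<in> simplices Y (Suc n)" and g: "g \<in> simplices G (Suc n)"
      and z: "z \<in> simplices (t_space G (h_space G Y)) n"
      and eq: "(fst \<circ> snd) z = face Y (Suc n) (Suc n) y"
    obtain b' g' where z_eq: "z = (b', (face Y (Suc n) (Suc n) y, g'))"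
      using eq by (metis comp_apply prod.collapse)
    have b': "b' \<in> simplices (BG G) n" and g': "g' \<in> simplices G n"
      using z by (auto simp: z_eq)
    \<comment> \<open>The \<open>G\<close>-coordinate of the last face of \<open>(y, g)\<close> in
      \<open>h_space\<close>.\<close>
    define d where "d = gmult G n (tau_BG (proj Y (Suc n) y)) (face G (Suc n) (Suc n) g)"
    have d: "d \<in> simplices G n"
      using g y by (simp add: d_def face_closed tau_BG_closed Y.map_closed)
    \<comment> \<open>In \<open>t_space\<close> the entry \<open>a\<close> acts on this face by its
      inverse from the right, so it must solve \<open>gmult G n d (ginv n a) = g'\<close>.\<close>
    define a where "a = gmult G n (ginv n g') d"
    have a: "a \<in> simplices G n" using d g' by (simp add: a_def)
    show "\<exists>!u. u \<in> simplices (t_space G (h_space G Y)) (Suc n) \<and> (fst \<circ> snd) u = y \<and>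
      (snd \<circ> snd) u = g \<and> face (t_space G (h_space G Y)) (Suc n) (Suc n) u = z"
    proof (rule ex1I[of _ "(b' @ [a], (y, g))"])
      have "gmult G n d (ginv n a) = g'"
        using g' d by (simp add: a_def ginv_gmult flip: gmult_assoc)
      then show "(b' @ [a], (y, g)) \<in> simplices (t_space G (h_space G Y)) (Suc n) \<and>
        (fst \<circ> snd) (b' @ [a], (y, g)) = y \<and> (snd \<circ> snd) (b' @ [a], (y, g)) = g \<and>
        face (t_space G (h_space G Y)) (Suc n) (Suc n) (b' @ [a], (y, g)) = z"
        using y g BG_snoc[OF b' a] by (simp add: z_eq flip: d_def)
    next
      fix u
      assume u: "u \<in> simplices (t_space G (h_space G Y)) (Suc n) \<and> (fst \<circ> snd) u = y \<and>
        (snd \<circ> snd) u = g \<and> face (t_space G (h_space G Y)) (Suc n) (Suc n) u = z"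
      then obtain b where u_eq: "u = (b, (y, g))" by (metis comp_apply prod.collapse)
      have b: "b \<in> simplices (BG G) (Suc n)" and db: "face (BG G) (Suc n) (Suc n) b = b'"
        and tau: "gmult G n d (ginv n (tau_BG b)) = g'"
        using u by (auto simp: u_eq z_eq d_def)
      have "tau_BG b = a"
        using tau_BG_closed[OF b] d by (simp add: a_def ginv_gmult gmult_assoc flip: tau)
      then have "b = b' @ [a]"
        using BG_snoc[OF b' a] db by (intro BG_Suc_eqI[OF b]) simp_all
      then show "u = (b' @ [a], (y, g))" by (simp add: u_eq)
    qed
  qed (auto simp: face_gone degen_gone)
qed

lemma homotopy_equivalence_P_map:
  assumes "left_gspace G X"
  shows "homotopy_equivalence (h_space G (t_space G X)) X (P_map G X)"
  \<comment> \<open>Unwinding the recursion, the inverse sends \<open>x\<close> to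
    \<open>(([1, ..., 1], x), 1)\<close>.\<close>
  by (rule pointed_cofree_map.homotopy_equivalence_retraction[OF pointed_cofree_map_P_map[OF assms]])

text \<open>I is the section of the projection to \<open>Y\<close> with \<open>G\<close>-coordinate
  1, so the projection is its homotopy inverse.\<close>

lemma homotopy_equivalence_I_map:
  assumes "space_over (BG G) Y"
  shows "homotopy_equivalence Y (t_space G (h_space G Y)) (I_map G Y)"
proof -
  interpret I: space_over_map "BG G" Y "t_space G (h_space G Y)" "I_map G Y"
    by (rule space_over_map_I_map[OF assms])
  show ?thesis
    by (rule pointed_cofree_map.homotopy_equivalence_section(1)[OF
          pointed_cofree_map_projection[OF assms] I.simplicial_map_axioms])
      (simp_all add: I_map_def)
qed

end

theorem theorem2p11:
  fixes G :: "'g sgroup"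
  assumes "simplicial_group G"
  shows
    "(\<forall>X :: ('x, 'g) gspace. left_gspace G X \<longrightarrow>
        gspace_map G (h_space G (t_space G X)) X (P_map G X) \<and>
        homotopy_equivalence (h_space G (t_space G X)) X (P_map G X)) \<and>
     (\<forall>Y :: ('y, 'g list) over_space. space_over (BG G) Y \<longrightarrow>
        space_over_map (BG G) Y (t_space G (h_space G Y)) (I_map G Y) \<and>
        homotopy_equivalence Y (t_space G (h_space G Y)) (I_map G Y))"
proof -
  interpret simplicial_group G by fact
  show ?thesis
    using gspace_map_P_map homotopy_equivalence_P_map space_over_map_I_map homotopy_equivalence_I_map
    by blast
qed

end
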